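(* Let $G$ be a graph and let $k\geq\chi(G)$ be a positive integer. Then there exists an ordering of the vertices of $G$ such that the robust-greedy algorithm with $H=\overline{G}$ and colors $1,\dots,k$, applied to this ordering, produces a $k$-robust coloring of $(G,\overline{G})$.
   Context: All graphs are finite, simple and unweighted; $\overline{G}$ is the complement of $G$ and $\chi(G)$ its chromatic number. A $k$-coloring of $G$ is a map $\phi:V(G)\to\{1,\dots,k\}$ with $\phi(u)\neq\phi(v)$ for every edge $uv$ of $G$. For a subgraph $H$ of $\overline{G}$, an edge $uv$ of $H$ is monochromatic if $\phi(u)=\phi(v)$; a $k$-robust coloring of $(G,H)$ is a $k$-coloring of $G$ minimizing the number of monochromatic edges of $H$ over all $k$-colorings of $G$. Robust-greedy algorithm (for $G$, a fixed subgraph $H$ of $\overline{G}$, colors $1,\dots,k$ and a vertex ordering): the vertices are processed in the given order, and each vertex $v$ receives the smallest color $c\in\{1,\dots,k\}$ such that (a) $c$ is available for $v$, i.e. no already colored neighbour of $v$ in $G$ has color $c$, and (b) among all available colors, $c$ minimizes the number of already colored neighbours of $v$ in $H$ having that color (i.e. the number of monochromatic edges of $H$ with endpoint $v$ created at that step). The algorithm stops when all vertices are colored. *)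

theory Defs
  imports "HOL-Library.Ramsey"
begin

text \<open>A graph is a pair of a vertex set and a set of two-element sets of vertices.\<close>

type_synonym 'a ugraph = "'a set \<times> 'a set set"

abbreviation verts :: "'a ugraph \<Rightarrow> 'a set" where
  "verts G \<equiv> fst G"

abbreviation edges :: "'a ugraph \<Rightarrow> 'a set set" where
  "edges G \<equiv> snd G"

definition simple_graph :: "'a ugraph \<Rightarrow> bool" where
  "simple_graph G \<longleftrightarrow> finite (verts G) \<and> edges G \<subseteq> [verts G]\<^bsup>2\<^esup>"

definition complement :: "'a ugraph \<Rightarrow> 'a ugraph" where
  "complement G = (verts G, [verts G]\<^bsup>2\<^esup> - edges G)"

text \<open>Colorings are partial maps, so that the intermediate states of the greedy algorithm
  (only some vertices colored) and complete colorings have the same type.\<close>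

definition k_coloring :: "nat \<Rightarrow> 'a ugraph \<Rightarrow> ('a \<rightharpoonup> nat) \<Rightarrow> bool" where
  "k_coloring k G \<phi> \<longleftrightarrow> dom \<phi> = verts G \<and> ran \<phi> \<subseteq> {1..k} \<and>
     (\<forall>u v. {u, v} \<in> edges G \<longrightarrow> \<phi> u \<noteq> \<phi> v)"

definition chromatic_number :: "'a ugraph \<Rightarrow> nat" where
  "chromatic_number G = (LEAST k. \<exists>\<phi>. k_coloring k G \<phi>)"

definition monochromatic_edges :: "'a ugraph \<Rightarrow> ('a \<rightharpoonup> nat) \<Rightarrow> 'a set set" where
  "monochromatic_edges H \<phi> = {e \<in> edges H. \<exists>u v. e = {u, v} \<and> \<phi> u = \<phi> v}"

text \<open>In the following definitions \<open>H\<close> is meant to be a subgraph of \<open>complement G\<close>.\<close>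

definition robust_coloring :: "nat \<Rightarrow> 'a ugraph \<Rightarrow> 'a ugraph \<Rightarrow> ('a \<rightharpoonup> nat) \<Rightarrow> bool" where
  "robust_coloring k G H \<phi> \<longleftrightarrow>
     is_arg_min (\<lambda>\<psi>. card (monochromatic_edges H \<psi>)) (k_coloring k G) \<phi>"

definition available_colors :: "'a ugraph \<Rightarrow> nat \<Rightarrow> ('a \<rightharpoonup> nat) \<Rightarrow> 'a \<Rightarrow> nat set" where
  "available_colors G k \<phi> v = {c \<in> {1..k}. \<nexists>u. {u, v} \<in> edges G \<and> \<phi> u = Some c}"

definition color_cost :: "'a ugraph \<Rightarrow> ('a \<rightharpoonup> nat) \<Rightarrow> 'a \<Rightarrow> nat \<Rightarrow> nat" where
  "color_cost H \<phi> v c = card {u. {u, v} \<in> edges H \<and> \<phi> u = Some c}"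

definition greedy_color :: "'a ugraph \<Rightarrow> 'a ugraph \<Rightarrow> nat \<Rightarrow> ('a \<rightharpoonup> nat) \<Rightarrow> 'a \<Rightarrow> nat" where
  "greedy_color G H k \<phi> v =
     (LEAST c. is_arg_min (color_cost H \<phi> v) (\<lambda>c. c \<in> available_colors G k \<phi> v) c)"

text \<open>The run fails (\<open>None\<close>) if it reaches a vertex for which no color is available.\<close>

fun robust_greedy_from ::
  "'a ugraph \<Rightarrow> 'a ugraph \<Rightarrow> nat \<Rightarrow> ('a \<rightharpoonup> nat) \<Rightarrow> 'a list \<Rightarrow> ('a \<rightharpoonup> nat) option" where
  "robust_greedy_from G H k \<phi> [] = Some \<phi>"
| "robust_greedy_from G H k \<phi> (v # vs) =
     (if available_colors G k \<phi> v = {} then None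
      else robust_greedy_from G H k (\<phi>(v \<mapsto> greedy_color G H k \<phi> v)) vs)"

definition robust_greedy ::
  "'a ugraph \<Rightarrow> 'a ugraph \<Rightarrow> nat \<Rightarrow> 'a list \<Rightarrow> ('a \<rightharpoonup> nat) option" where
  "robust_greedy G H k vs = robust_greedy_from G H k Map.empty vs"

end

theory Submission
  imports Defs "HOL-Combinatorics.Transposition"
begin

text \<open>Since \<open>H\<close> is the complement of \<open>G\<close>, the cost of an available color is the current size of its
  color class. Fix a robust coloring \<open>\<phi>\<close> whose class sizes do not increase with the color, and
  always process next an uncolored vertex \<open>v\<close> whose color \<open>i\<close> under \<open>\<phi>\<close> has the currently smallest
  class, preferring small colors, among the classes that are not yet complete. Greedy then
  reproduces \<open>\<phi>\<close>: an available color \<open>j\<close> that beats \<open>i\<close> belongs to a complete class; if that class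
  is smaller than the current class \<open>i\<close>, then recoloring \<open>v\<close> with \<open>j\<close> destroys more monochromatic
  edges than it creates, and if it has the same size with \<open>j < i\<close>, then the final class of \<open>j\<close> is
  smaller than that of \<open>i\<close>, against the choice of \<open>\<phi>\<close>.\<close>

section \<open>Edges, complements and color classes\<close>

abbreviation color_class :: "('a \<rightharpoonup> nat) \<Rightarrow> nat \<Rightarrow> 'a set" where
  "color_class \<phi> c \<equiv> {u. \<phi> u = Some c}"

lemma pair_in_nsets_2_iff: "{u, v} \<in> [V]\<^bsup>2\<^esup> \<longleftrightarrow> u \<in> V \<and> v \<in> V \<and> u \<noteq> v"
  by (auto simp: nsets_def card_2_iff card_insert_if)

lemma simple_graph_edgeD:
  "simple_graph G \<Longrightarrow> {u, v} \<in> edges G \<Longrightarrow> u \<in> verts G \<and> v \<in> verts G \<and> u \<noteq> v"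
  unfolding simple_graph_def using pair_in_nsets_2_iff[of u v "verts G"] by blast

lemma edges_complement_iff:
  "{u, v} \<in> edges (complement G) \<longleftrightarrow> u \<in> verts G \<and> v \<in> verts G \<and> u \<noteq> v \<and> {u, v} \<notin> edges G"
  using pair_in_nsets_2_iff[of u v "verts G"] by (auto simp: complement_def)

lemma finite_edges_complement: "simple_graph G \<Longrightarrow> finite (edges (complement G))"
  by (simp add: complement_def simple_graph_def finite_imp_finite_nsets)

lemma k_coloring_SomeD: "k_coloring k G \<phi> \<Longrightarrow> \<phi> v = Some c \<Longrightarrow> v \<in> verts G \<and> c \<in> {1..k}"
  unfolding k_coloring_def by (auto intro: ranI)

lemma k_coloring_colored: "k_coloring k G \<phi> \<Longrightarrow> v \<in> verts G \<Longrightarrow> \<exists>c. \<phi> v = Some c"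
  unfolding k_coloring_def by blast

lemma k_coloring_edgeD: "k_coloring k G \<phi> \<Longrightarrow> {u, v} \<in> edges G \<Longrightarrow> \<phi> u \<noteq> \<phi> v"
  unfolding k_coloring_def by blast

lemma finite_color_class:
  "simple_graph G \<Longrightarrow> k_coloring k G \<phi> \<Longrightarrow> finite (color_class \<phi> c)"
  by (rule finite_subset[of _ "verts G"]) (auto simp: simple_graph_def dest: k_coloring_SomeD)

text \<open>An injective numbering of the vertices is a coloring, so the \<open>LEAST\<close> in
  \<open>chromatic_number\<close> is attained; a coloring survives any enlargement of the
  palette.\<close>

lemma k_coloring_exists:
  assumes G: "simple_graph G" and k: "chromatic_number G \<le> k"
  shows "\<exists>\<phi>. k_coloring k G \<phi>"
proof -
  have "finite (verts G)"
    using G by (simp add: simple_graph_def)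
  then obtain f :: "'a \<Rightarrow> nat" where f: "bij_betw f (verts G) {1..card (verts G)}"
    using finite_same_card_bij[of "verts G" "{1..card (verts G)}"] by auto
  have inj: "f u \<noteq> f v" if "u \<in> verts G" "v \<in> verts G" "u \<noteq> v" for u v
    using f that by (auto simp: bij_betw_def inj_on_def)
  have "k_coloring (card (verts G)) G (\<lambda>v. if v \<in> verts G then Some (f v) else None)"
    unfolding k_coloring_def
  proof (intro conjI allI impI)
    show "ran (\<lambda>v. if v \<in> verts G then Some (f v) else None) \<subseteq> {1..card (verts G)}"
      using f by (auto simp: ran_def bij_betw_def split: if_splits)
  qed (use simple_graph_edgeD[OF G] inj in \<open>auto simp: dom_def\<close>)
  then have "\<exists>\<phi>. k_coloring (chromatic_number G) G \<phi>"
    unfolding chromatic_number_def by (intro LeastI) blast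
  then obtain \<phi> where "k_coloring (chromatic_number G) G \<phi>" ..
  then have "k_coloring k G \<phi>"
    using k unfolding k_coloring_def by fastforce
  then show ?thesis
    by blast
qed

section \<open>Recoloring a single vertex\<close>

text \<open>A color class is independent in \<open>G\<close>, hence a clique in the complement. So
  the monochromatic edges at \<open>v\<close> correspond to the other vertices of its class.\<close>

lemma card_monochromatic_edges_at:
  assumes G: "simple_graph G" and col: "k_coloring k G \<phi>" and v: "\<phi> v = Some c"
  shows "card (monochromatic_edges (complement G) \<phi>) =
    card {e \<in> monochromatic_edges (complement G) \<phi>. v \<notin> e} + card (color_class \<phi> c - {v})"
proof -
  let ?M = "monochromatic_edges (complement G) \<phi>"
  have "{e \<in> ?M. v \<in> e} = (\<lambda>u. {u, v}) ` (color_class \<phi> c - {v})"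
  proof (intro equalityI subsetI)
    fix e assume "e \<in> {e \<in> ?M. v \<in> e}"
    then obtain u w where e: "e \<in> edges (complement G)" "e = {u, w}" "\<phi> u = \<phi> w" "v \<in> e"
      by (auto simp: monochromatic_edges_def)
    then have "u \<noteq> w"
      by (simp add: edges_complement_iff)
    then have "e = {u, v} \<and> u \<noteq> v \<and> \<phi> u = Some c \<or> e = {w, v} \<and> w \<noteq> v \<and> \<phi> w = Some c"
      using e v by auto
    then show "e \<in> (\<lambda>u. {u, v}) ` (color_class \<phi> c - {v})"
      by blast
  next
    fix e assume "e \<in> (\<lambda>u. {u, v}) ` (color_class \<phi> c - {v})"
    then obtain u where u: "e = {u, v}" "\<phi> u = Some c" "u \<noteq> v"
      by auto
    moreover have "{u, v} \<notin> edges G"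
      using k_coloring_edgeD[OF col, of u v] u v by auto
    ultimately have "{u, v} \<in> edges (complement G)"
      using k_coloring_SomeD[OF col] v by (simp add: edges_complement_iff)
    then show "e \<in> {e \<in> ?M. v \<in> e}"
      unfolding monochromatic_edges_def using u(1,2) v by force
  qed
  moreover have "inj_on (\<lambda>u. {u, v}) (color_class \<phi> c - {v})"
    by (auto simp: inj_on_def doubleton_eq_iff)
  ultimately have "card {e \<in> ?M. v \<in> e} = card (color_class \<phi> c - {v})"
    by (simp add: card_image)
  moreover have "finite ?M"
    using finite_edges_complement[OF G] by (simp add: monochromatic_edges_def)
  then have "card ?M = card {e \<in> ?M. v \<notin> e} + card {e \<in> ?M. v \<in> e}"
    by (subst card_Un_disjoint[symmetric]) (auto intro!: arg_cong[where f = card])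
  ultimately show ?thesis
    by simp
qed

text \<open>Moving \<open>v\<close> from class \<open>i\<close> to class \<open>j\<close> loses one
  monochromatic edge for each other vertex of class \<open>i\<close> and gains one for each vertex
  of class \<open>j\<close>. Minimality forbids a net loss; the \<open>Suc\<close> accounts for
  \<open>v\<close> itself.\<close>

lemma robust_coloring_class_le:
  assumes G: "simple_graph G" and rob: "robust_coloring k G (complement G) \<phi>"
    and v: "\<phi> v = Some i" and j: "j \<in> available_colors G k \<phi> v" and ne: "i \<noteq> j"
  shows "card (color_class \<phi> i) \<le> Suc (card (color_class \<phi> j))"
proof -
  let ?\<psi> = "\<phi>(v \<mapsto> j)" and ?M = "monochromatic_edges (complement G)"
  have col: "k_coloring k G \<phi>"
    using rob by (simp add: robust_coloring_def is_arg_min_def)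
  have nonadj: "\<phi> u \<noteq> Some j" if "{u, v} \<in> edges G \<or> {v, u} \<in> edges G" for u
    using j that by (auto simp: available_colors_def insert_commute)
  have col': "k_coloring k G ?\<psi>"
    unfolding k_coloring_def
  proof (intro conjI allI impI)
    show "dom ?\<psi> = verts G"
      using col k_coloring_SomeD[OF col v] by (auto simp: k_coloring_def)
    show "ran ?\<psi> \<subseteq> {1..k}"
      using col j by (auto simp: k_coloring_def available_colors_def ran_def split: if_splits)
    show "?\<psi> u \<noteq> ?\<psi> w" if e: "{u, w} \<in> edges G" for u w
      using simple_graph_edgeD[OF G e] e col nonadj[of u] nonadj[of w]
      by (auto simp: k_coloring_def)
  qed
  \<comment> \<open>The colorings differ only at \<open>v\<close>, so the edges avoiding
    \<open>v\<close> cancel in the comparison.\<close>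
  have "{e \<in> ?M ?\<psi>. v \<notin> e} = {e \<in> ?M \<phi>. v \<notin> e}"
    unfolding monochromatic_edges_def by fastforce
  moreover have "color_class ?\<psi> j - {v} = color_class \<phi> j"
    using v ne by auto
  moreover have "card (?M \<phi>) \<le> card (?M ?\<psi>)"
    using rob col' by (simp add: robust_coloring_def is_arg_min_linorder)
  ultimately have "card (color_class \<phi> i - {v}) \<le> card (color_class \<phi> j)"
    using card_monochromatic_edges_at[OF G col v]
      card_monochromatic_edges_at[OF G col', of v j] by simp
  then show ?thesis
    using v by (simp add: card_Diff_singleton_if)
qed

section \<open>Exchanging two colors and sorting the classes\<close>

lemma k_coloring_transpose:
  assumes "k_coloring k G \<phi>" "i \<in> {1..k}" "j \<in> {1..k}"
  shows "k_coloring k G (map_option (transpose i j) \<circ> \<phi>)"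
proof -
  have "inj (map_option (transpose i j))"
    by (simp add: option.inj_map)
  then have "map_option (transpose i j) x = map_option (transpose i j) y \<longleftrightarrow> x = y" for x y
    by (simp add: inj_eq)
  moreover have "ran (map_option (transpose i j) \<circ> \<phi>) = transpose i j ` ran \<phi>"
    by (auto simp: ran_def)
  ultimately show ?thesis
    using assms by (auto simp: k_coloring_def transpose_def dom_def)
qed

lemma monochromatic_edges_transpose:
  "monochromatic_edges H (map_option (transpose i j) \<circ> \<phi>) = monochromatic_edges H \<phi>"
proof -
  have "inj (map_option (transpose i j))"
    by (simp add: option.inj_map)
  then show ?thesis
    by (simp add: monochromatic_edges_def inj_eq)
qed

text \<open>The sum of all colors serves as a potential for sorting: giving the larger class the
  smaller color decreases it.\<close>

lemma sum_colors_transpose_less: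
  assumes "finite (verts G)" and col: "k_coloring k G \<phi>"
    and "j < i" and less: "card (color_class \<phi> j) < card (color_class \<phi> i)"
  shows "(\<Sum>v\<in>verts G. the ((map_option (transpose i j) \<circ> \<phi>) v)) < (\<Sum>v\<in>verts G. the (\<phi> v))"
proof -
  let ?\<psi> = "map_option (transpose i j) \<circ> \<phi>"
  let ?A = "color_class \<phi> i" and ?B = "color_class \<phi> j"
  let ?R = "verts G - ?A - ?B"
  have V: "verts G = ?R \<union> (?A \<union> ?B)"
    using k_coloring_SomeD[OF col] by auto
  then have fin: "finite ?A" "finite ?B" "finite ?R"
    using assms(1) by (metis finite_Un)+
  have split: "sum f (verts G) = sum f ?R + (sum f ?A + sum f ?B)" for f :: "'a \<Rightarrow> nat"
  proof -
    have "sum f (verts G) = sum f (?R \<union> (?A \<union> ?B))"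
      using V by simp
    also have "\<dots> = sum f ?R + sum f (?A \<union> ?B)"
      using fin by (intro sum.union_disjoint) auto
    also have "sum f (?A \<union> ?B) = sum f ?A + sum f ?B"
      using fin \<open>j < i\<close> by (intro sum.union_disjoint) auto
    finally show ?thesis .
  qed
  have R: "(\<Sum>v\<in>?R. the (?\<psi> v)) = (\<Sum>v\<in>?R. the (\<phi> v))"
  proof (rule sum.cong)
    fix v assume "v \<in> ?R"
    moreover from this obtain c where "\<phi> v = Some c"
      using k_coloring_colored[OF col] by blast
    ultimately show "the (?\<psi> v) = the (\<phi> v)"
      by (auto simp: transpose_def)
  qed simp
  obtain d where d: "card ?A = card ?B + Suc d"
    using less less_iff_Suc_add[of "card ?B"] by auto
  \<comment> \<open>An instance of the rearrangement inequality; the left side is what both classes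
    contribute after the exchange, the right side what they contribute before.\<close>
  have "card ?A * j + card ?B * i < card ?A * i + card ?B * j"
    using \<open>j < i\<close> by (simp add: d add_mult_distrib add_less_le_mono)
  then show ?thesis
    unfolding split R by simp
qed

text \<open>Among the robust colorings, one with the least sum of colors is taken. Exchanging two
  colors keeps a coloring robust, so a pair of classes in the wrong order would allow a smaller
  sum.\<close>

lemma robust_coloring_sorted_exists:
  assumes G: "simple_graph G" and k: "chromatic_number G \<le> k"
  obtains \<phi> where "robust_coloring k G (complement G) \<phi>"
    and "\<And>i j. j \<in> {1..k} \<Longrightarrow> i \<in> {1..k} \<Longrightarrow> j < i \<Longrightarrow>
      card (color_class \<phi> i) \<le> card (color_class \<phi> j)"
proof -
  let ?rob = "robust_coloring k G (complement G)"
  let ?total = "\<lambda>\<phi>. \<Sum>v\<in>verts G. the (\<phi> v)"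
  obtain \<phi>0 where "k_coloring k G \<phi>0"
    using k_coloring_exists[OF G k] by blast
  from ex_has_least_nat[of "k_coloring k G", OF this,
      of "\<lambda>\<psi>. card (monochromatic_edges (complement G) \<psi>)"]
  obtain \<phi>1 where "?rob \<phi>1"
    unfolding robust_coloring_def is_arg_min_linorder by blast
  from ex_has_least_nat[of ?rob, OF this, of ?total]
  obtain \<phi> where rob: "?rob \<phi>" and min: "\<And>\<psi>. ?rob \<psi> \<Longrightarrow> ?total \<phi> \<le> ?total \<psi>"
    by blast
  have col: "k_coloring k G \<phi>"
    using rob by (simp add: robust_coloring_def is_arg_min_def)
  have "card (color_class \<phi> i) \<le> card (color_class \<phi> j)"
    if ij: "j \<in> {1..k}" "i \<in> {1..k}" "j < i" for i j
  proof (rule ccontr)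
    assume "\<not> ?thesis"
    then have "(\<Sum>v\<in>verts G. the ((map_option (transpose i j) \<circ> \<phi>) v))
        < (\<Sum>v\<in>verts G. the (\<phi> v))"
      using G ij(3) by (intro sum_colors_transpose_less[OF _ col]) (auto simp: simple_graph_def)
    moreover have "?rob (map_option (transpose i j) \<circ> \<phi>)"
      using rob k_coloring_transpose[OF col ij(2,1)]
      by (simp add: robust_coloring_def is_arg_min_def monochromatic_edges_transpose)
    ultimately show False
      using min[of "map_option (transpose i j) \<circ> \<phi>"] by simp
  qed
  with rob show ?thesis
    by (rule that)
qed

section \<open>The greedy choice at a partial coloring\<close>

text \<open>No vertex of an available class is adjacent to \<open>v\<close> in \<open>G\<close>, so
  all of them are adjacent to \<open>v\<close> in the complement; \<open>v\<close> itself is not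
  counted, being uncolored.\<close>

lemma color_cost_complement:
  assumes "simple_graph G" and "dom \<phi> \<subseteq> verts G" and "v \<in> verts G" and "\<phi> v = None"
    and "c \<in> available_colors G k \<phi> v"
  shows "color_cost (complement G) \<phi> v c = card (color_class \<phi> c)"
  unfolding color_cost_def
  using assms by (intro arg_cong[where f = card])
    (auto simp: edges_complement_iff available_colors_def)

lemma greedy_color_eqI:
  assumes "i \<in> available_colors G k \<phi> v"
    and "\<And>j. j \<in> available_colors G k \<phi> v \<Longrightarrow>
      color_cost H \<phi> v i < color_cost H \<phi> v j \<or> color_cost H \<phi> v i = color_cost H \<phi> v j \<and> i \<le> j"
  shows "greedy_color G H k \<phi> v = i"
  unfolding greedy_color_def is_arg_min_linorder
proof (rule Least_equality)
  fix j assume "j \<in> available_colors G k \<phi> v \<and>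
    (\<forall>c. c \<in> available_colors G k \<phi> v \<longrightarrow> color_cost H \<phi> v j \<le> color_cost H \<phi> v c)"
  then show "i \<le> j"
    using assms by force
qed (use assms in \<open>force\<close>)

text \<open>One step of the run: the states to be maintained are exactly the restrictions of
  \<open>\<phi>\<close> to the set \<open>S\<close> of processed vertices.\<close>

lemma greedy_extends_sorted_robust_coloring:
  assumes G: "simple_graph G" and rob: "robust_coloring k G (complement G) \<phi>"
    and sorted: "\<And>i j. j \<in> {1..k} \<Longrightarrow> i \<in> {1..k} \<Longrightarrow> j < i \<Longrightarrow>
      card (color_class \<phi> i) \<le> card (color_class \<phi> j)"
    and S: "S \<subset> verts G"
  obtains v where "v \<in> verts G - S" and "available_colors G k (\<phi> |` S) v \<noteq> {}"
    and "\<phi> v = Some (greedy_color G (complement G) k (\<phi> |` S) v)"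
proof -
  let ?cur = "\<lambda>c. card (color_class (\<phi> |` S) c)"
  let ?U = "{c. \<exists>v \<in> verts G - S. \<phi> v = Some c}"
  have col: "k_coloring k G \<phi>"
    using rob by (simp add: robust_coloring_def is_arg_min_def)
  have cur_sub: "color_class (\<phi> |` S) c \<subseteq> color_class \<phi> c" for c
    by (auto simp: restrict_map_def split: if_splits)
  have "?U \<noteq> {}"
    using S k_coloring_colored[OF col] by blast
  then obtain c0 where c0: "c0 \<in> ?U"
    by blast
  then obtain i0 where i0: "i0 \<in> ?U" "\<And>c. c \<in> ?U \<Longrightarrow> ?cur i0 \<le> ?cur c"
    using ex_has_least_nat[of "\<lambda>c. c \<in> ?U" c0 ?cur] by blast
  \<comment> \<open>Among the incomplete classes tied for the smallest current size the least color
    is taken, to match the tie-breaking of the greedy rule.\<close>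
  define i where "i = (LEAST i. i \<in> ?U \<and> ?cur i = ?cur i0)"
  have i: "i \<in> ?U" "?cur i = ?cur i0"
    using LeastI[of "\<lambda>i. i \<in> ?U \<and> ?cur i = ?cur i0" i0] i0(1) unfolding i_def by blast+
  have i_min: "?cur i < ?cur c \<or> ?cur i = ?cur c \<and> i \<le> c" if "c \<in> ?U" for c
    using i0(2)[OF that] i(2) that Least_le[of "\<lambda>i. i \<in> ?U \<and> ?cur i = ?cur i0" c]
    unfolding i_def[symmetric] by linarith
  obtain v where v: "v \<in> verts G - S" "\<phi> v = Some i"
    using i(1) by blast
  have "?cur i < card (color_class \<phi> i)"
  proof (rule psubset_card_mono[OF finite_color_class[OF G col]])
    have "v \<in> color_class \<phi> i - color_class (\<phi> |` S) i"
      using v by simp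
    then show "color_class (\<phi> |` S) i \<subset> color_class \<phi> i"
      using cur_sub[of i] by blast
  qed
  note cur_less = this
  have avail: "i \<in> available_colors G k (\<phi> |` S) v"
    using k_coloring_SomeD[OF col v(2)] k_coloring_edgeD[OF col, of _ v] v(2)
    by (auto simp: available_colors_def restrict_map_def split: if_splits)
  have cost: "color_cost (complement G) (\<phi> |` S) v c = ?cur c"
    if "c \<in> available_colors G k (\<phi> |` S) v" for c
    using v S that by (intro color_cost_complement[OF G]) auto
  have "greedy_color G (complement G) k (\<phi> |` S) v = i"
  proof (rule greedy_color_eqI[OF avail])
    fix j assume j: "j \<in> available_colors G k (\<phi> |` S) v"
    have "?cur i < ?cur j \<or> ?cur i = ?cur j \<and> i \<le> j"
    proof (cases "j \<in> ?U")
      case True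
      then show ?thesis
        by (rule i_min)
    next
      case False
      then have completed: "\<phi> u = Some j \<Longrightarrow> (\<phi> |` S) u = Some j" for u
        using k_coloring_SomeD[OF col, of u j] by (auto simp: restrict_map_def)
      then have full: "color_class (\<phi> |` S) j = color_class \<phi> j"
        using cur_sub[of j] by blast
      have "i \<noteq> j"
        using False i(1) by blast
      \<comment> \<open>Class \<open>j\<close> lies inside \<open>S\<close>, so no vertex outside
        \<open>S\<close> can become a conflicting neighbour of \<open>v\<close>.\<close>
      moreover have "j \<in> available_colors G k \<phi> v"
        using j completed by (auto simp: available_colors_def)
      ultimately have "card (color_class \<phi> i) \<le> Suc (?cur j)"
        unfolding full by (intro robust_coloring_class_le[OF G rob v(2)])
      moreover have "card (color_class \<phi> i) \<le> ?cur j" if "j < i"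
        unfolding full using that k_coloring_SomeD[OF col v(2)] j
        by (intro sorted) (auto simp: available_colors_def)
      \<comment> \<open>The strict \<open>cur_less\<close> absorbs the \<open>Suc\<close> and gives
        \<open>?cur i \<le> ?cur j\<close>. For \<open>j < i\<close> the sorting makes this strict,
        so no tie is lost to the smaller color.\<close>
      ultimately show ?thesis
        using cur_less by linarith
    qed
    then show "color_cost (complement G) (\<phi> |` S) v i < color_cost (complement G) (\<phi> |` S) v j \<or>
        color_cost (complement G) (\<phi> |` S) v i = color_cost (complement G) (\<phi> |` S) v j \<and> i \<le> j"
      using cost[OF avail] cost[OF j] by simp
  qed
  with v avail that show ?thesis
    by auto
qed

section \<open>Assembling the ordering\<close>

text \<open>Induction on the number of uncolored vertices. The vertex from \<open>step\<close> goes
  to the front of the list; since greedy gives it its color under \<open>\<phi>\<close>, the next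
  state is again a restriction of \<open>\<phi>\<close>.\<close>

lemma robust_greedy_from_reproduces:
  assumes "finite V" and "dom \<phi> = V" and "S \<subseteq> V"
    and step: "\<And>S. S \<subset> V \<Longrightarrow> \<exists>v \<in> V - S. available_colors G k (\<phi> |` S) v \<noteq> {} \<and>
      \<phi> v = Some (greedy_color G H k (\<phi> |` S) v)"
  shows "\<exists>vs. distinct vs \<and> set vs = V - S \<and> robust_greedy_from G H k (\<phi> |` S) vs = Some \<phi>"
  using \<open>S \<subseteq> V\<close>
proof (induction "card (V - S)" arbitrary: S)
  case 0
  then have "V = S"
    using \<open>finite V\<close> by auto
  then have "\<phi> |` S = \<phi>"
    using \<open>dom \<phi> = V\<close> by (auto simp: restrict_map_def dom_def)
  then show ?case
    using \<open>V = S\<close> by (intro exI[of _ "[]"]) simp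
next
  case (Suc n)
  then have "S \<subset> V"
    by auto
  then obtain v where v: "v \<in> V - S" "available_colors G k (\<phi> |` S) v \<noteq> {}"
      "\<phi> v = Some (greedy_color G H k (\<phi> |` S) v)"
    using step by blast
  have "V - insert v S = (V - S) - {v}"
    by blast
  then have "n = card (V - insert v S)"
    using Suc.hyps(2) v(1) by simp
  then obtain vs where vs: "distinct vs" "set vs = V - insert v S"
      "robust_greedy_from G H k (\<phi> |` insert v S) vs = Some \<phi>"
    using Suc.hyps(1)[of "insert v S"] Suc.prems v(1) by blast
  have "(\<phi> |` S)(v \<mapsto> greedy_color G H k (\<phi> |` S) v) = \<phi> |` insert v S"
    using v(3) by (auto simp: restrict_map_def fun_eq_iff)
  then have "robust_greedy_from G H k (\<phi> |` S) (v # vs) = Some \<phi>"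
    using v(2) vs(3) by simp
  then show ?case
    using vs(1,2) v(1) by (intro exI[of _ "v # vs"]) auto
qed

theorem theorem5:
  fixes G :: "'a ugraph" and k :: nat
  assumes "simple_graph G" and "k > 0" and "k \<ge> chromatic_number G"
  shows "\<exists>vs. distinct vs \<and> set vs = verts G \<and>
           (\<exists>\<phi>. robust_greedy G (complement G) k vs = Some \<phi> \<and>
                robust_coloring k G (complement G) \<phi>)"
proof -
  obtain \<phi> where rob: "robust_coloring k G (complement G) \<phi>"
    and sorted: "\<And>i j. j \<in> {1..k} \<Longrightarrow> i \<in> {1..k} \<Longrightarrow> j < i \<Longrightarrow>
      card (color_class \<phi> i) \<le> card (color_class \<phi> j)"
    using robust_coloring_sorted_exists[OF assms(1,3)] by blast
  have dom: "dom \<phi> = verts G"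
    using rob by (simp add: robust_coloring_def is_arg_min_def k_coloring_def)
  have "\<exists>v \<in> verts G - S. available_colors G k (\<phi> |` S) v \<noteq> {} \<and>
      \<phi> v = Some (greedy_color G (complement G) k (\<phi> |` S) v)" if "S \<subset> verts G" for S
    using greedy_extends_sorted_robust_coloring[OF assms(1) rob sorted that] by blast
  \<comment> \<open>The run starts from \<open>S = {}\<close>, where the restriction of
    \<open>\<phi>\<close> is \<open>Map.empty\<close>.\<close>
  then obtain vs where "distinct vs" "set vs = verts G"
      "robust_greedy_from G (complement G) k (\<phi> |` {}) vs = Some \<phi>"
    using robust_greedy_from_reproduces[of "verts G" \<phi> "{}" G k "complement G"] assms(1) dom
    by (auto simp: simple_graph_def)
  with rob show ?thesis
    by (auto simp: robust_greedy_def)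
qed

end
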